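(* Let $\mathscr T=(V,E)$ be a rooted directed tree with root $\mathsf{root}$ and let $\mathscr T_\infty$ be the extended directed tree associated with $\mathscr T$, with vertex set $V_\infty=V\sqcup\{\infty\}$. Let $b,u\in V$ and let $\lambda_u=\{\lambda_{uv}\}_{v\in V_\infty}$ be a weight system of complex numbers. Then the weighted join operator $W^{(b)}_{\lambda_u}$ on $\mathscr T$ defines a densely defined closed linear operator in $\ell^2(V)$. Moreover, $\mathscr D_V:=\mathrm{span}\{e_v:v\in V\}$ forms a core for $W^{(b)}_{\lambda_u}$.
   Context: Trees. A directed tree $\mathscr T=(V,E)$ is a directed graph (no loops, $V$ and $E$ nonempty) which has no circuits, is connected (ignoring orientation), and in which every non-root vertex $v$ has exactly one parent $\mathsf{par}(v)$ (the $p$ with $(p,v)\in E$); a root is a vertex with no parent, and $\mathscr T$ is rooted if it has a unique root $\mathsf{root}$. Throughout $\mathrm{card}(V)=\aleph_0$. $\mathsf{Des}(u)$ is the set of descendants of $u$, including $u$; $\mathsf{Asc}(u)=\{\mathsf{par}^{\langle n\rangle}(u):n\ge1\}$ is the set of strict ancestors. The depth $\mathsf d_u$ is the length of the directed path from $\mathsf{root}$ to $u$. Join operations. The extended tree $\mathscr T_\infty$ has vertex set $V_\infty=V\sqcup\{\infty\}$ and $\infty$ is declared a child (hence a descendant) of every $v\in V$. For $u,v\in V_\infty$: $u\sqcup v=u$ if $u\in\mathsf{Des}(v)$; $=v$ if $v\in\mathsf{Des}(u)$; $=\infty$ otherwise. For $u,v\in V$, $u\sqcap v$ is the vertex of largest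 depth among $\{w\in V:\mathsf{par}^{\langle n\rangle}(u)=w=\mathsf{par}^{\langle m\rangle}(v)\text{ for some }m,n\ge0\}$. For $b\in V$ the join at the base point $b$ is $u\sqcup_bv=u\sqcap v$ if $u,v\in\mathsf{Asc}(b)$; $=u$ if $v=b$; $=v$ if $u=b$; $=u\sqcup v$ otherwise. Weighted join operator. A weight system is a family $\lambda_u=\{\lambda_{uv}\}_{v\in V_\infty}\subseteq\mathbb C$ with $\lambda_{u\infty}=0$. For $f:V\to\mathbb C$ put $(\Lambda^{(b)}_uf)(w)=\sum_{v\in V:\,u\sqcup_bv=w}\lambda_{uv}f(v)$, $w\in V$. Then $\mathscr D(W^{(b)}_{\lambda_u})=\{f\in\ell^2(V):\Lambda^{(b)}_uf\in\ell^2(V)\}$ and $W^{(b)}_{\lambda_u}f=\Lambda^{(b)}_uf$. $\{e_v\}_{v\in V}$ is the standard orthonormal basis of $\ell^2(V)$. A dense subspace $\mathscr D\subseteq\mathscr D(T)$ is a core of a closable operator $T$ if $\overline{T|_{\mathscr D}}=\overline T$. *)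

theory Defs
  imports "HOL-Analysis.Analysis" "HOL-Library.Function_Algebras"
begin

section \<open>Directed trees\<close>

(* A graph is a vertex set V with an edge relation E; (p, v) \<in> E reads "p is a parent of v". *)

definition is_root :: "'v set \<Rightarrow> ('v \<times> 'v) set \<Rightarrow> 'v \<Rightarrow> bool" where
  "is_root V E v \<longleftrightarrow> v \<in> V \<and> (\<nexists>p. (p, v) \<in> E)"

(* "acyclic" excludes loops as well as circuits of length at least two. *)
definition directed_tree :: "'v set \<Rightarrow> ('v \<times> 'v) set \<Rightarrow> bool" where
  "directed_tree V E \<longleftrightarrow>
     V \<noteq> {} \<and> E \<noteq> {} \<and> E \<subseteq> V \<times> V \<and> acyclic E \<and>
     (\<forall>u\<in>V. \<forall>v\<in>V. (u, v) \<in> (E \<union> E\<inverse>)\<^sup>*) \<and>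
     (\<forall>v\<in>V. \<not> is_root V E v \<longrightarrow> (\<exists>!p. (p, v) \<in> E))"

definition rooted_directed_tree :: "'v set \<Rightarrow> ('v \<times> 'v) set \<Rightarrow> bool" where
  "rooted_directed_tree V E \<longleftrightarrow> directed_tree V E \<and> (\<exists>!r. is_root V E r)"

definition root_of :: "'v set \<Rightarrow> ('v \<times> 'v) set \<Rightarrow> 'v" where
  "root_of V E = (THE r. is_root V E r)"

definition par :: "('v \<times> 'v) set \<Rightarrow> 'v \<Rightarrow> 'v option" where
  "par E v = (if \<exists>p. (p, v) \<in> E then Some (THE p. (p, v) \<in> E) else None)"

(* par_iter E n v is the n-th ancestor of v, None if par cannot be iterated n times. *)
primrec par_iter :: "('v \<times> 'v) set \<Rightarrow> nat \<Rightarrow> 'v \<Rightarrow> 'v option" where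
  "par_iter E 0 v = Some v"
| "par_iter E (Suc n) v = Option.bind (par_iter E n v) (par E)"

definition Asc :: "('v \<times> 'v) set \<Rightarrow> 'v \<Rightarrow> 'v set" where
  "Asc E u = {w. \<exists>n\<ge>1. par_iter E n u = Some w}"

definition Des :: "('v \<times> 'v) set \<Rightarrow> 'v \<Rightarrow> 'v set" where
  "Des E u = {v. (u, v) \<in> E\<^sup>*}"

definition depth :: "'v set \<Rightarrow> ('v \<times> 'v) set \<Rightarrow> 'v \<Rightarrow> nat" where
  "depth V E u = (THE n. (root_of V E, u) \<in> E ^^ n)"


section \<open>Join operations\<close>

(* The extended vertex set is the set Some ` V \<union> {None}, with None playing the role of \<infinity>. *)

definition ext_edges :: "'v set \<Rightarrow> ('v \<times> 'v) set \<Rightarrow> ('v option \<times> 'v option) set" where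
  "ext_edges V E = {(Some u, Some v) | u v. (u, v) \<in> E} \<union> {(Some v, None) | v. v \<in> V}"

definition join :: "'v set \<Rightarrow> ('v \<times> 'v) set \<Rightarrow> 'v option \<Rightarrow> 'v option \<Rightarrow> 'v option" where
  "join V E x y =
     (if x \<in> Des (ext_edges V E) y then x
      else if y \<in> Des (ext_edges V E) x then y
      else None)"

definition meet :: "'v set \<Rightarrow> ('v \<times> 'v) set \<Rightarrow> 'v \<Rightarrow> 'v \<Rightarrow> 'v" where
  "meet V E u v =
     (ARG_MAX (depth V E) w.
        w \<in> V \<and> (\<exists>m n. par_iter E n u = Some w \<and> par_iter E m v = Some w))"

definition join_at ::
    "'v set \<Rightarrow> ('v \<times> 'v) set \<Rightarrow> 'v \<Rightarrow> 'v option \<Rightarrow> 'v option \<Rightarrow> 'v option" where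
  "join_at V E b x y =
     (if x \<in> Some ` Asc E b \<and> y \<in> Some ` Asc E b then Some (meet V E (the x) (the y))
      else if y = Some b then x
      else if x = Some b then y
      else join V E x y)"


section \<open>The space of square-summable functions\<close>

(* Functions on V are represented by functions on the whole type that vanish outside V. *)
definition ell2 :: "'v set \<Rightarrow> ('v \<Rightarrow> complex) set" where
  "ell2 V = {f. (\<forall>v. v \<notin> V \<longrightarrow> f v = 0) \<and> (\<lambda>v. (cmod (f v))\<^sup>2) summable_on V}"

definition ell2_norm :: "'v set \<Rightarrow> ('v \<Rightarrow> complex) \<Rightarrow> real" where
  "ell2_norm V f = sqrt (\<Sum>\<^sub>\<infinity>v\<in>V. (cmod (f v))\<^sup>2)"

definition ell2_topology :: "'v set \<Rightarrow> ('v \<Rightarrow> complex) topology" where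
  "ell2_topology V = Metric_space.mtopology (ell2 V) (\<lambda>f g. ell2_norm V (f - g))"

definition scaleF :: "complex \<Rightarrow> ('v \<Rightarrow> complex) \<Rightarrow> 'v \<Rightarrow> complex" where
  "scaleF c f = (\<lambda>v. c * f v)"

definition basis_vec :: "'v \<Rightarrow> 'v \<Rightarrow> complex" where
  "basis_vec v = (\<lambda>w. if w = v then 1 else 0)"


section \<open>Unbounded operators\<close>

(* An operator is a pair (domain, action); values of the action off the domain are irrelevant. *)
type_synonym 'v operator = "('v \<Rightarrow> complex) set \<times> (('v \<Rightarrow> complex) \<Rightarrow> ('v \<Rightarrow> complex))"

definition linear_operator :: "'v set \<Rightarrow> 'v operator \<Rightarrow> bool" where
  "linear_operator V T \<longleftrightarrow>
     fst T \<subseteq> ell2 V \<and> module.subspace scaleF (fst T) \<and> snd T ` fst T \<subseteq> ell2 V \<and>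
     (\<forall>f\<in>fst T. \<forall>g\<in>fst T. snd T (f + g) = snd T f + snd T g) \<and>
     (\<forall>c. \<forall>f\<in>fst T. snd T (scaleF c f) = scaleF c (snd T f))"

definition dense_in_ell2 :: "'v set \<Rightarrow> ('v \<Rightarrow> complex) set \<Rightarrow> bool" where
  "dense_in_ell2 V D \<longleftrightarrow> D \<subseteq> ell2 V \<and> ell2_topology V closure_of D = ell2 V"

definition graph :: "'v operator \<Rightarrow> (('v \<Rightarrow> complex) \<times> ('v \<Rightarrow> complex)) set" where
  "graph T = {(f, snd T f) | f. f \<in> fst T}"

definition closed_operator :: "'v set \<Rightarrow> 'v operator \<Rightarrow> bool" where
  "closed_operator V T \<longleftrightarrow>
     closedin (prod_topology (ell2_topology V) (ell2_topology V)) (graph T)"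

definition closure_graph ::
    "'v set \<Rightarrow> 'v operator \<Rightarrow> (('v \<Rightarrow> complex) \<times> ('v \<Rightarrow> complex)) set" where
  "closure_graph V T =
     prod_topology (ell2_topology V) (ell2_topology V) closure_of graph T"

definition closable_operator :: "'v set \<Rightarrow> 'v operator \<Rightarrow> bool" where
  "closable_operator V T \<longleftrightarrow> single_valued (closure_graph V T)"

definition is_core :: "'v set \<Rightarrow> 'v operator \<Rightarrow> ('v \<Rightarrow> complex) set \<Rightarrow> bool" where
  "is_core V T D \<longleftrightarrow>
     closable_operator V T \<and>
     D \<subseteq> fst T \<and> module.subspace scaleF D \<and> dense_in_ell2 V D \<and>
     closure_graph V (D, snd T) = closure_graph V T"


section \<open>Weighted join operators\<close>

(* The weights are those of the fixed vertex u: lam x stands for lambda_{u x}. *)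

definition Lam ::
    "'v set \<Rightarrow> ('v \<times> 'v) set \<Rightarrow> 'v \<Rightarrow> 'v \<Rightarrow> ('v option \<Rightarrow> complex) \<Rightarrow>
     ('v \<Rightarrow> complex) \<Rightarrow> 'v \<Rightarrow> complex" where
  "Lam V E b u lam f =
     (\<lambda>w. if w \<in> V
          then \<Sum>\<^sub>\<infinity>v \<in> {v \<in> V. join_at V E b (Some u) (Some v) = Some w}. lam (Some v) * f v
          else 0)"

definition weighted_join ::
    "'v set \<Rightarrow> ('v \<times> 'v) set \<Rightarrow> 'v \<Rightarrow> 'v \<Rightarrow> ('v option \<Rightarrow> complex) \<Rightarrow> 'v operator" where
  "weighted_join V E b u lam = ({f \<in> ell2 V. Lam V E b u lam f \<in> ell2 V}, Lam V E b u lam)"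

end

theory Submission
  imports Defs
begin

text \<open>
  The join \<open>v \<mapsto> u \<squnion>\<^sub>b v\<close> is almost the identity: a vertex \<open>v\<close> that is neither the base point \<open>b\<close> nor
  an ancestor of \<open>u\<close> or \<open>b\<close> is sent to \<open>v\<close> itself (if it is a descendant of \<open>u\<close>, or if \<open>u = b\<close>) or
  to \<open>\<infinity>\<close>. In a rooted tree every vertex has only finitely many ancestors, so the exceptional
  vertices lie in a finite set \<open>F\<close> (\<open>join_at_almost_diagonal\<close>). Hence the weighted join operator \<open>W\<close>
  is a diagonal operator off \<open>F\<close>, and each coordinate of \<open>W f\<close> is a finite linear
  combination of coordinates of \<open>f\<close>.

  Closedness: if \<open>f\<^sub>n \<rightarrow> f\<close> and \<open>W f\<^sub>n \<rightarrow> g\<close> in \<open>\<ell>\<^sup>2(V)\<close>, then both sequences converge coordinatewise,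
  and a coordinate of \<open>W f\<close> depends continuously on finitely many coordinates of \<open>f\<close>;
  so \<open>g = W f\<close>, and then \<open>f\<close> is in the maximal domain because \<open>g\<close> is square-summable.

  Core: if \<open>A\<close> is a finite set that contains \<open>F\<close> and the vertices to which \<open>F\<close> is sent, then
  multiplication by the indicator of \<open>A\<close> commutes with \<open>W\<close> (\<open>row_op_truncate\<close>).
  For \<open>f\<close> in the domain of \<open>W\<close>, the truncations of \<open>f\<close> to such sets \<open>A\<close> lie in the span of the basis
  vectors, they converge to \<open>f\<close>, and their images are the truncations of \<open>W f\<close>, which converge to
  \<open>W f\<close>. The closedness of \<open>W\<close> then turns this graph approximation into the core property.
\<close>

section \<open>The metric space of square-summable functions\<close>

lemma L2_set_le_ell2_norm:
  assumes "f \<in> ell2 V" "finite A" "A \<subseteq> V"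
  shows "L2_set (\<lambda>v. cmod (f v)) A \<le> ell2_norm V f"
  using assms unfolding L2_set_def ell2_norm_def ell2_def
  by (auto intro!: real_sqrt_le_mono finite_sum_le_infsum)

lemma norm_le_ell2_norm:
  assumes "f \<in> ell2 V" "v \<in> V"
  shows "cmod (f v) \<le> ell2_norm V f"
  using L2_set_le_ell2_norm[OF assms(1), of "{v}"] assms(2) by simp

text \<open>Square-summability and norm bounds can be tested on finite sets of coordinates; this reduces
  the Minkowski inequality for \<open>\<ell>\<^sup>2(V)\<close> to the one for finite sums.\<close>

lemma ell2_if_L2_set_bounded:
  assumes supp: "\<And>v. v \<notin> V \<Longrightarrow> f v = 0"
    and bound: "\<And>A. finite A \<Longrightarrow> A \<subseteq> V \<Longrightarrow> L2_set (\<lambda>v. cmod (f v)) A \<le> C"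
  shows "f \<in> ell2 V" "ell2_norm V f \<le> C"
proof -
  have C: "0 \<le> C" using bound[of "{}"] by simp
  have sq: "(\<Sum>v\<in>A. (cmod (f v))\<^sup>2) \<le> C\<^sup>2" if "finite A" "A \<subseteq> V" for A
    using bound[OF that] C unfolding L2_set_def by (metis sqrt_le_D)
  have summ: "(\<lambda>v. (cmod (f v))\<^sup>2) summable_on V"
    by (rule nonneg_bdd_above_summable_on) (auto intro!: bdd_aboveI2[where M = "C\<^sup>2"] sq)
  then show "f \<in> ell2 V" using supp by (auto simp: ell2_def)
  have "(\<Sum>\<^sub>\<infinity>v\<in>V. (cmod (f v))\<^sup>2) \<le> C\<^sup>2"
    by (rule infsum_le_finite_sums[OF summ]) (use sq in auto)
  then show "ell2_norm V f \<le> C"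
    unfolding ell2_norm_def using C by (rule real_le_lsqrt[rotated])
qed

lemma ell2_add:
  assumes f: "f \<in> ell2 V" and g: "g \<in> ell2 V"
  shows "f + g \<in> ell2 V" "ell2_norm V (f + g) \<le> ell2_norm V f + ell2_norm V g"
proof -
  have supp: "(f + g) v = 0" if "v \<notin> V" for v
    using f g that by (auto simp: ell2_def)
  have bound: "L2_set (\<lambda>v. cmod ((f + g) v)) A \<le> ell2_norm V f + ell2_norm V g"
    if "finite A" "A \<subseteq> V" for A
  proof -
    have "L2_set (\<lambda>v. cmod ((f + g) v)) A \<le> L2_set (\<lambda>v. cmod (f v) + cmod (g v)) A"
      by (rule L2_set_mono) (auto intro: norm_triangle_ineq)
    also have "\<dots> \<le> L2_set (\<lambda>v. cmod (f v)) A + L2_set (\<lambda>v. cmod (g v)) A"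
      by (rule L2_set_triangle_ineq)
    also have "\<dots> \<le> ell2_norm V f + ell2_norm V g"
      by (intro add_mono L2_set_le_ell2_norm f g that)
    finally show ?thesis .
  qed
  show "f + g \<in> ell2 V" "ell2_norm V (f + g) \<le> ell2_norm V f + ell2_norm V g"
    by (rule ell2_if_L2_set_bounded[OF supp bound]; assumption)+
qed

lemma ell2_scaleF:
  assumes "f \<in> ell2 V"
  shows "scaleF c f \<in> ell2 V"
  using assms
  by (auto simp: ell2_def scaleF_def norm_mult power_mult_distrib intro!: summable_on_cmult_right)

lemma ell2_finite_support:
  assumes "finite {v. f v \<noteq> 0}" "{v. f v \<noteq> 0} \<subseteq> V"
  shows "f \<in> ell2 V"
proof -
  have "(\<lambda>v. (cmod (f v))\<^sup>2) summable_on {v. f v \<noteq> 0}"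
    using assms(1) by (rule summable_on_finite)
  also have "?this \<longleftrightarrow> (\<lambda>v. (cmod (f v))\<^sup>2) summable_on V"
    by (rule summable_on_cong_neutral) (use assms(2) in auto)
  finally show ?thesis using assms(2) by (auto simp: ell2_def)
qed

lemma zero_in_ell2: "0 \<in> ell2 V"
  by (simp add: ell2_def)

lemma scaleF_minus_one: "scaleF (- 1) f = - f"
  by (simp add: scaleF_def fun_eq_iff)

lemma ell2_diff:
  assumes "f \<in> ell2 V" "g \<in> ell2 V"
  shows "f - g \<in> ell2 V"
  using ell2_add(1)[OF assms(1) ell2_scaleF[OF assms(2), of "- 1"]]
  by (simp add: scaleF_minus_one)

lemma ell2_norm_zero_iff:
  assumes "f \<in> ell2 V"
  shows "ell2_norm V f = 0 \<longleftrightarrow> f = 0"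
proof
  assume "ell2_norm V f = 0"
  then have "f v = 0" for v
    using norm_le_ell2_norm[OF assms, of v] assms by (cases "v \<in> V") (auto simp: ell2_def)
  then show "f = 0" by (simp add: fun_eq_iff)
qed (simp add: ell2_norm_def)

lemma Metric_space_ell2: "Metric_space (ell2 V) (\<lambda>f g. ell2_norm V (f - g))"
proof
  fix f g h :: "'a \<Rightarrow> complex"
  show "0 \<le> ell2_norm V (f - g)"
    by (simp add: ell2_norm_def infsum_nonneg)
  show "ell2_norm V (f - g) = ell2_norm V (g - f)"
    by (simp add: ell2_norm_def norm_minus_commute)
  assume f: "f \<in> ell2 V" and g: "g \<in> ell2 V"
  show "ell2_norm V (f - g) = 0 \<longleftrightarrow> f = g"
    using ell2_norm_zero_iff[OF ell2_diff[OF f g]] by simp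
  assume h: "h \<in> ell2 V"
  show "ell2_norm V (f - h) \<le> ell2_norm V (f - g) + ell2_norm V (g - h)"
    using ell2_add(2)[OF ell2_diff[OF f g] ell2_diff[OF g h]] by simp
qed

lemma ell2_closure_of:
  assumes "S \<subseteq> ell2 V"
  shows "f \<in> ell2_topology V closure_of S \<longleftrightarrow>
    f \<in> ell2 V \<and> (\<forall>e>0. \<exists>f'\<in>S. ell2_norm V (f - f') < e)"
proof -
  interpret Metric_space "ell2 V" "\<lambda>f g. ell2_norm V (f - g)"
    by (rule Metric_space_ell2)
  show ?thesis
    using assms unfolding ell2_topology_def metric_closure_of by (auto simp: in_mball) blast+
qed

lemma ell2_prod_closure_of:
  assumes "S \<subseteq> ell2 V \<times> ell2 V"
  shows "(f, g) \<in> prod_topology (ell2_topology V) (ell2_topology V) closure_of S \<longleftrightarrow>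
    f \<in> ell2 V \<and> g \<in> ell2 V \<and>
    (\<forall>e>0. \<exists>(f', g')\<in>S. ell2_norm V (f - f') < e \<and> ell2_norm V (g - g') < e)"
    (is "?L \<longleftrightarrow> ?R")
proof -
  let ?d = "\<lambda>f g. ell2_norm V (f - g)"
  interpret Metric_space12 "ell2 V" ?d "ell2 V" ?d
    by (simp add: Metric_space12_def Metric_space_ell2)
  have topo: "prod_topology (ell2_topology V) (ell2_topology V) = Prod_metric.mtopology"
    by (simp add: mtopology_prod_metric ell2_topology_def)
  have ge: "?d x x' \<le> prod_dist ?d ?d (x, y) (x', y')" "?d y y' \<le> prod_dist ?d ?d (x, y) (x', y')"
    and le: "prod_dist ?d ?d (x, y) (x', y') \<le> ?d x x' + ?d y y'" for x y x' y'
    unfolding prod_dist_def by (auto simp: sqrt_sum_squares_le_sum)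
  show ?thesis
  proof
    assume L: ?L
    then have fg: "f \<in> ell2 V" "g \<in> ell2 V"
      unfolding topo Prod_metric.metric_closure_of by auto
    have "\<exists>(f', g')\<in>S. ?d f f' < e \<and> ?d g g' < e" if "e > 0" for e
    proof -
      obtain f' g' where "(f', g') \<in> S" "prod_dist ?d ?d (f, g) (f', g') < e"
        using L \<open>e > 0\<close> unfolding topo Prod_metric.metric_closure_of Prod_metric.in_mball by force
      then show ?thesis
        using ge(1)[of f f' g g'] ge(2)[of g g' f f'] by (intro bexI[of _ "(f', g')"]) auto
    qed
    with fg show ?R by blast
  next
    assume R: ?R
    have "\<exists>y\<in>S. y \<in> Prod_metric.mball (f, g) e" if "e > 0" for e
    proof -
      have "\<exists>(f', g')\<in>S. ?d f f' < e / 2 \<and> ?d g g' < e / 2"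
        using R \<open>e > 0\<close> half_gt_zero by blast
      then obtain f' g' where "(f', g') \<in> S" "?d f f' < e / 2" "?d g g' < e / 2" by blast
      then show ?thesis using R assms le[of f g f' g']
        by (intro bexI[of _ "(f', g')"]) (auto simp: Prod_metric.in_mball)
    qed
    then show ?L using R unfolding topo Prod_metric.metric_closure_of by auto
  qed
qed

section \<open>Truncation to finite sets of coordinates\<close>

definition truncate :: "'v set \<Rightarrow> ('v \<Rightarrow> complex) \<Rightarrow> 'v \<Rightarrow> complex" where
  "truncate A f = (\<lambda>v. if v \<in> A then f v else 0)"

lemma truncate_approx:
  assumes f: "f \<in> ell2 V" and "e > 0"
  shows "\<forall>\<^sub>F A in finite_subsets_at_top V. ell2_norm V (f - truncate A f) < e"
proof -
  let ?q = "\<lambda>v. (cmod (f v))\<^sup>2"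
  have summ: "?q summable_on V" using f by (simp add: ell2_def)
  have "\<forall>\<^sub>F A in finite_subsets_at_top V. dist (sum ?q A) (infsum ?q V) < e\<^sup>2"
    using infsum_tendsto[OF summ] by (rule tendstoD) (use \<open>e > 0\<close> in simp)
  moreover have "\<forall>\<^sub>F A in finite_subsets_at_top V. finite A \<and> A \<subseteq> V"
    by (rule eventually_finite_subsets_at_top_weakI) auto
  ultimately show ?thesis
  proof eventually_elim
    case (elim A)
    have "(\<Sum>\<^sub>\<infinity>v\<in>V. (cmod ((f - truncate A f) v))\<^sup>2) = infsum ?q (V - A)"
      by (rule infsum_cong_neutral) (auto simp: truncate_def)
    also have "\<dots> = infsum ?q V - sum ?q A"
      using infsum_Diff[OF summ summable_on_finite, of A] elim by simp
    also have "\<dots> < e\<^sup>2" using elim by (simp add: dist_real_def)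
    finally show ?case unfolding ell2_norm_def using \<open>e > 0\<close>
      by (metis abs_of_pos real_sqrt_abs real_sqrt_less_mono)
  qed
qed

lemma vector_space_scaleF: "vector_space (scaleF :: complex \<Rightarrow> ('v \<Rightarrow> complex) \<Rightarrow> 'v \<Rightarrow> complex)"
  by unfold_locales (auto simp: scaleF_def fun_eq_iff algebra_simps)

interpretation fun_vs: vector_space "scaleF :: complex \<Rightarrow> ('v \<Rightarrow> complex) \<Rightarrow> 'v \<Rightarrow> complex"
  by (rule vector_space_scaleF)

lemma truncate_in_span:
  assumes "finite A" "A \<subseteq> V"
  shows "truncate A f \<in> fun_vs.span (basis_vec ` V)"
proof -
  have "truncate A f = (\<Sum>v\<in>A. scaleF (f v) (basis_vec v))"
  proof
    fix w
    have "(\<Sum>v\<in>A. scaleF (f v) (basis_vec v)) w = (\<Sum>v\<in>A. if v = w then f v else 0)"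
      using assms(1)
      by (induction A rule: finite_induct) (auto simp: scaleF_def basis_vec_def)
    also have "\<dots> = truncate A f w" using assms(1) by (simp add: truncate_def)
    finally show "truncate A f w = (\<Sum>v\<in>A. scaleF (f v) (basis_vec v)) w" ..
  qed
  also have "\<dots> \<in> fun_vs.span (basis_vec ` V)"
    using assms(2) by (intro fun_vs.span_sum fun_vs.span_scale fun_vs.span_base) auto
  finally show ?thesis .
qed

lemma span_basis_vec_subset_ell2: "fun_vs.span (basis_vec ` V) \<subseteq> ell2 V"
proof (rule fun_vs.span_minimal)
  show "basis_vec ` V \<subseteq> ell2 V"
    by (auto intro!: ell2_finite_support simp: basis_vec_def split: if_splits)
  show "fun_vs.subspace (ell2 V)"
    by (rule fun_vs.subspaceI) (auto simp: zero_in_ell2 ell2_add ell2_scaleF)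
qed

lemma dense_span_basis_vec: "dense_in_ell2 V (fun_vs.span (basis_vec ` V))"
proof -
  have "f \<in> ell2_topology V closure_of fun_vs.span (basis_vec ` V)" if f: "f \<in> ell2 V" for f
    unfolding ell2_closure_of[OF span_basis_vec_subset_ell2]
  proof (intro conjI allI impI f)
    fix e :: real assume "e > 0"
    then obtain A where "finite A" "A \<subseteq> V" "ell2_norm V (f - truncate A f) < e"
      using truncate_approx[OF f] unfolding eventually_finite_subsets_at_top by blast
    then show "\<exists>f'\<in>fun_vs.span (basis_vec ` V). ell2_norm V (f - f') < e"
      using truncate_in_span by blast
  qed
  then show ?thesis
    using span_basis_vec_subset_ell2[of V] unfolding dense_in_ell2_def
    by (auto simp: ell2_closure_of)
qed

lemma dense_in_ell2_mono:
  assumes "dense_in_ell2 V D" "D \<subseteq> D'" "D' \<subseteq> ell2 V"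
  shows "dense_in_ell2 V D'"
proof -
  have "ell2_topology V closure_of D' \<subseteq> ell2 V"
    using ell2_closure_of[OF assms(3)] by blast
  then show ?thesis
    using assms closure_of_mono[OF assms(2), of "ell2_topology V"]
    unfolding dense_in_ell2_def by blast
qed

section \<open>Operators that are diagonal off a finite set\<close>

text \<open>These data encode a matrix indexed by \<open>V\<close>: column \<open>v\<close> has the entry \<open>c v\<close> in row \<open>\<phi> v\<close> and is
  zero elsewhere; it vanishes entirely if \<open>\<phi> v = None\<close>, which stands for the vertex \<open>\<infinity>\<close>. Off the finite set \<open>F\<close> this entry lies on the diagonal.\<close>

locale almost_diagonal =
  fixes V :: "'v set" and \<phi> :: "'v \<Rightarrow> 'v option" and c :: "'v \<Rightarrow> complex" and F :: "'v set"
  assumes finite_exceptional: "finite F"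
    and diagonal: "\<And>v. v \<in> V \<Longrightarrow> v \<notin> F \<Longrightarrow> \<phi> v = Some v \<or> \<phi> v = None"
begin

definition row_op :: "('v \<Rightarrow> complex) \<Rightarrow> 'v \<Rightarrow> complex" where
  "row_op f = (\<lambda>w. if w \<in> V then \<Sum>\<^sub>\<infinity>v \<in> {v \<in> V. \<phi> v = Some w}. c v * f v else 0)"

definition max_op :: "'v operator" where
  "max_op = ({f \<in> ell2 V. row_op f \<in> ell2 V}, row_op)"

lemma fiber_subset: "{v \<in> V. \<phi> v = Some w} \<subseteq> insert w F"
  using diagonal by force

lemma finite_fiber: "finite {v \<in> V. \<phi> v = Some w}"
  using fiber_subset by (rule finite_subset) (simp add: finite_exceptional)

lemma row_op_eq_sum: "w \<in> V \<Longrightarrow> row_op f w = (\<Sum>v | v \<in> V \<and> \<phi> v = Some w. c v * f v)"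
  by (simp add: row_op_def infsum_finite[OF finite_fiber])

lemma row_op_outside: "w \<notin> V \<Longrightarrow> row_op f w = 0"
  by (simp add: row_op_def)

lemma row_op_add: "row_op (f + g) = row_op f + row_op g"
proof
  fix w
  show "row_op (f + g) w = (row_op f + row_op g) w"
    by (cases "w \<in> V") (simp_all add: row_op_eq_sum row_op_outside distrib_left sum.distrib)
qed

lemma row_op_scaleF: "row_op (scaleF a f) = scaleF a (row_op f)"
proof
  fix w
  show "row_op (scaleF a f) w = scaleF a (row_op f) w"
    by (cases "w \<in> V")
      (simp_all add: row_op_eq_sum row_op_outside scaleF_def sum_distrib_left mult.left_commute)
qed

lemma row_op_zero: "row_op 0 = 0"
  by (simp add: row_op_def fun_eq_iff)

lemma subspace_max_op: "fun_vs.subspace (fst max_op)"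
  by (rule fun_vs.subspaceI)
    (auto simp: max_op_def zero_in_ell2 ell2_add ell2_scaleF row_op_add row_op_scaleF row_op_zero)

lemma linear_max_op: "linear_operator V max_op"
  using subspace_max_op
  by (auto simp: linear_operator_def max_op_def row_op_add row_op_scaleF)

lemma basis_vec_in_max_op:
  assumes "v \<in> V"
  shows "basis_vec v \<in> fst max_op"
proof -
  have "row_op (basis_vec v) w = 0" if "w \<notin> set_option (\<phi> v)" for w
  proof (cases "w \<in> V")
    case True
    then show ?thesis using that
      by (auto simp: row_op_eq_sum basis_vec_def intro!: sum.neutral)
  qed (simp add: row_op_outside)
  then have supp: "{w. row_op (basis_vec v) w \<noteq> 0} \<subseteq> set_option (\<phi> v)" by blast
  have "row_op (basis_vec v) \<in> ell2 V"
  proof (rule ell2_finite_support)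
    show "finite {w. row_op (basis_vec v) w \<noteq> 0}"
      by (rule finite_subset[OF supp]) simp
    show "{w. row_op (basis_vec v) w \<noteq> 0} \<subseteq> V" using row_op_outside by blast
  qed
  moreover have "basis_vec v \<in> ell2 V"
    using span_basis_vec_subset_ell2 fun_vs.span_base assms by blast
  ultimately show ?thesis by (simp add: max_op_def)
qed

lemma span_subset_max_op: "fun_vs.span (basis_vec ` V) \<subseteq> fst max_op"
  by (rule fun_vs.span_minimal) (use basis_vec_in_max_op subspace_max_op in auto)

lemma graph_max_op_subset: "graph max_op \<subseteq> ell2 V \<times> ell2 V"
  by (auto simp: graph_def max_op_def)

text \<open>Convergence in norm implies convergence of coordinates, and each row of the matrix has only
  finitely many nonzero entries, so the equation \<open>g = row_op f\<close> passes to limits row by row.\<close>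

lemma closed_max_op: "closed_operator V max_op"
proof -
  let ?X = "prod_topology (ell2_topology V) (ell2_topology V)"
  have "(f, g) \<in> graph max_op" if cl: "(f, g) \<in> ?X closure_of graph max_op" for f g
  proof -
    have fg: "f \<in> ell2 V" "g \<in> ell2 V"
      and approx: "\<And>e. e > 0 \<Longrightarrow> \<exists>f'\<in>fst max_op.
            ell2_norm V (f - f') < e \<and> ell2_norm V (g - row_op f') < e"
      using cl unfolding ell2_prod_closure_of[OF graph_max_op_subset]
      by (auto simp: graph_def max_op_def)
    have "g w = row_op f w" for w
    proof (cases "w \<in> V")
      case w: True
      define R where "R = {v. v \<in> V \<and> \<phi> v = Some w}"
      (* The summand 1 pays for the error of g at w, the weights of row w for the error of f. *)
      define C where "C = 1 + (\<Sum>v\<in>R. cmod (c v))"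
      have C: "C > 0" unfolding C_def by (simp add: add_pos_nonneg sum_nonneg)
      have bound: "cmod (g w - row_op f w) \<le> C * e" if e: "e > 0" for e
      proof -
        obtain f' where f': "f' \<in> ell2 V" "row_op f' \<in> ell2 V"
            and le: "ell2_norm V (f - f') < e" "ell2_norm V (g - row_op f') < e"
          using approx[OF e] by (auto simp: max_op_def)
        have "cmod (row_op f' w - row_op f w) = cmod (\<Sum>v\<in>R. c v * (f' v - f v))"
          by (simp add: row_op_eq_sum w R_def sum_subtractf algebra_simps)
        also have "\<dots> \<le> (\<Sum>v\<in>R. cmod (c v) * cmod (f v - f' v))"
          by (rule order_trans[OF norm_sum]) (simp add: norm_mult norm_minus_commute)
        also have "\<dots> \<le> (\<Sum>v\<in>R. cmod (c v) * e)"
        proof (intro sum_mono mult_left_mono norm_ge_zero)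
          fix v assume "v \<in> R"
          then have "cmod ((f - f') v) \<le> ell2_norm V (f - f')"
            using norm_le_ell2_norm[OF ell2_diff[OF fg(1) f'(1)]] by (simp add: R_def)
          then show "cmod (f v - f' v) \<le> e" using le(1) by simp
        qed
        also have "\<dots> = (\<Sum>v\<in>R. cmod (c v)) * e" by (simp add: sum_distrib_right)
        finally have 1: "cmod (row_op f' w - row_op f w) \<le> (\<Sum>v\<in>R. cmod (c v)) * e" .
        have 2: "cmod (g w - row_op f' w) \<le> e"
          using norm_le_ell2_norm[OF ell2_diff[OF fg(2) f'(2)] w] le(2) by simp
        have "cmod (g w - row_op f w) \<le>
            cmod (g w - row_op f' w) + cmod (row_op f' w - row_op f w)"
          using norm_triangle_ineq[of "g w - row_op f' w" "row_op f' w - row_op f w"] by simp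
        with 1 2 show ?thesis by (simp add: C_def algebra_simps)
      qed
      have "cmod (g w - row_op f w) \<le> 0 + e" if "e > 0" for e
        using bound[of "e / C"] C that by simp
      then have "cmod (g w - row_op f w) \<le> 0" by (rule field_le_epsilon)
      then show ?thesis by simp
    next
      case False
      then show ?thesis using fg(2) by (simp add: ell2_def row_op_outside)
    qed
    then have "g = row_op f" by blast
    then show ?thesis using fg by (auto simp: graph_def max_op_def)
  qed
  then have "?X closure_of graph max_op \<subseteq> graph max_op" by auto
  moreover have "topspace (ell2_topology V) = ell2 V"
    unfolding ell2_topology_def by (rule Metric_space.topspace_mtopology[OF Metric_space_ell2])
  then have "graph max_op \<subseteq> topspace ?X"
    using graph_max_op_subset by simp
  ultimately show ?thesis
    unfolding closed_operator_def by (metis closure_of_subset closure_of_eq subset_antisym)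
qed

text \<open>If \<open>A\<close> contains \<open>F\<close> and its image, no matrix entry joins \<open>A\<close> to its complement:
  the off-diagonal entries are in columns from \<open>F\<close> and in rows from the image of \<open>F\<close>.\<close>

lemma row_op_truncate:
  assumes "A \<subseteq> V" "F \<inter> V \<subseteq> A" and image: "\<And>v w. v \<in> F \<Longrightarrow> \<phi> v = Some w \<Longrightarrow> w \<in> V \<Longrightarrow> w \<in> A"
  shows "row_op (truncate A f) = truncate A (row_op f)"
proof
  fix w
  consider "w \<in> A" | "w \<in> V" "w \<notin> A" | "w \<notin> V" using assms(1) by blast
  then show "row_op (truncate A f) w = truncate A (row_op f) w"
  proof cases
    case 1
    then have "v \<in> A" if "v \<in> V" "\<phi> v = Some w" for v
      using that fiber_subset[of w] assms(2) by blast
    with 1 assms(1) show ?thesis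
      by (auto simp: row_op_eq_sum truncate_def intro!: sum.cong)
  next
    case 2
    then have "v \<notin> A" if "v \<in> V" "\<phi> v = Some w" for v
      using that fiber_subset[of w] image by blast
    with 2 show ?thesis
      by (auto simp: row_op_eq_sum truncate_def intro!: sum.neutral)
  next
    case 3
    with assms(1) show ?thesis by (auto simp: row_op_outside truncate_def)
  qed
qed

lemma graph_truncation_approx:
  assumes f: "f \<in> fst max_op" and "e > 0"
  obtains A where "finite A" "A \<subseteq> V" "ell2_norm V (f - truncate A f) < e"
    "ell2_norm V (row_op f - row_op (truncate A f)) < e"
proof -
  (* Every finite set of vertices that contains B is admissible in row_op_truncate. *)
  define B where "B = V \<inter> (F \<union> (\<Union>v\<in>F. set_option (\<phi> v)))"
  have B: "finite B" "B \<subseteq> V" by (auto simp: B_def finite_exceptional)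
  have "f \<in> ell2 V" "row_op f \<in> ell2 V" using f by (auto simp: max_op_def)
  then have "\<forall>\<^sub>F A in finite_subsets_at_top V.
      ell2_norm V (f - truncate A f) < e \<and> ell2_norm V (row_op f - truncate A (row_op f)) < e"
    using truncate_approx \<open>e > 0\<close> by (intro eventually_conj)
  then obtain X where X: "finite X" "X \<subseteq> V"
    and large: "\<And>A. finite A \<and> X \<subseteq> A \<and> A \<subseteq> V \<Longrightarrow>
      ell2_norm V (f - truncate A f) < e \<and> ell2_norm V (row_op f - truncate A (row_op f)) < e"
    unfolding eventually_finite_subsets_at_top by blast
  have "row_op (truncate (X \<union> B) f) = truncate (X \<union> B) (row_op f)"
    by (rule row_op_truncate) (use X in \<open>auto simp: B_def\<close>)
  with that[of "X \<union> B"] large[of "X \<union> B"] X B show thesis by auto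
qed

lemma closure_graph_max_op: "closure_graph V max_op = graph max_op"
  using closed_max_op by (simp add: closed_operator_def closure_graph_def closure_of_eq)

text \<open>The graph of the restriction to the span is dense in the graph of the operator, and the latter
  is closed.\<close>

lemma span_core_max_op: "is_core V max_op (fun_vs.span (basis_vec ` V))"
proof -
  let ?D = "fun_vs.span (basis_vec ` V)"
  have sub: "graph (?D, snd max_op) \<subseteq> graph max_op"
    using span_subset_max_op by (auto simp: graph_def)
  have "closure_graph V (?D, snd max_op) = closure_graph V max_op"
  proof
    show "closure_graph V (?D, snd max_op) \<subseteq> closure_graph V max_op"
      unfolding closure_graph_def by (rule closure_of_mono[OF sub])
    have "(f, row_op f) \<in> closure_graph V (?D, snd max_op)" if f: "f \<in> fst max_op" for f
      unfolding closure_graph_def ell2_prod_closure_of[OF order_trans[OF sub graph_max_op_subset]]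
    proof (intro conjI allI impI)
      show "f \<in> ell2 V" "row_op f \<in> ell2 V" using f by (auto simp: max_op_def)
      fix e :: real assume "e > 0"
      then obtain A where A: "finite A" "A \<subseteq> V"
        and "ell2_norm V (f - truncate A f) < e"
          "ell2_norm V (row_op f - row_op (truncate A f)) < e"
        using graph_truncation_approx[OF f] by metis
      moreover have "(truncate A f, row_op (truncate A f)) \<in> graph (?D, snd max_op)"
        using truncate_in_span[OF A] by (auto simp: graph_def max_op_def)
      ultimately show "\<exists>(f', g')\<in>graph (?D, snd max_op).
          ell2_norm V (f - f') < e \<and> ell2_norm V (row_op f - g') < e" by blast
    qed
    then show "closure_graph V max_op \<subseteq> closure_graph V (?D, snd max_op)"
      unfolding closure_graph_max_op by (auto simp: graph_def max_op_def)
  qed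
  moreover have "closable_operator V max_op"
    unfolding closable_operator_def closure_graph_max_op
    by (auto simp: graph_def single_valued_def)
  ultimately show ?thesis
    unfolding is_core_def
    using span_subset_max_op dense_span_basis_vec fun_vs.subspace_span by blast
qed

end

section \<open>Ancestors and joins in a rooted tree\<close>

lemma rooted_directed_tree_unique_parent:
  assumes "rooted_directed_tree V E" "(p, v) \<in> E" "(q, v) \<in> E"
  shows "p = q"
proof -
  have "v \<in> V" "\<not> is_root V E v" "\<forall>v\<in>V. \<not> is_root V E v \<longrightarrow> (\<exists>!p. (p, v) \<in> E)"
    using assms by (auto simp: rooted_directed_tree_def directed_tree_def is_root_def)
  with assms(2,3) show ?thesis by blast
qed

text \<open>The set of descendants of the root is closed under taking children and, since parents are
  unique and the root has none, under taking parents. As the tree is connected, it contains all vertices.\<close>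

lemma root_reaches_all:
  assumes T: "rooted_directed_tree V E"
  obtains r where "is_root V E r" "\<And>v. v \<in> V \<Longrightarrow> (r, v) \<in> E\<^sup>*"
proof -
  obtain r where r: "is_root V E r"
    using T by (auto simp: rooted_directed_tree_def)
  have "(r, y) \<in> E\<^sup>*" if "(r, y) \<in> (E \<union> E\<inverse>)\<^sup>*" for y
    using that
  proof (induction rule: rtrancl_induct)
    case (step y z)
    show ?case
    proof (cases "(y, z) \<in> E")
      case True
      with step.IH show ?thesis by simp
    next
      case False
      with step.hyps have zy: "(z, y) \<in> E" by blast
      then have "y \<noteq> r" using r by (auto simp: is_root_def)
      with step.IH obtain q where "(r, q) \<in> E\<^sup>*" "(q, y) \<in> E" by (metis rtranclE)
      with zy rooted_directed_tree_unique_parent[OF T] show ?thesis by blast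
    qed
  qed simp
  moreover have "(r, v) \<in> (E \<union> E\<inverse>)\<^sup>*" if "v \<in> V" for v
    using T r that by (auto simp: rooted_directed_tree_def directed_tree_def is_root_def)
  ultimately show thesis using r that by blast
qed

lemma finite_ancestors:
  assumes T: "rooted_directed_tree V E" and "v \<in> V"
  shows "finite {w. (w, v) \<in> E\<^sup>*}"
proof -
  obtain r where r: "is_root V E r" and reach: "\<And>v. v \<in> V \<Longrightarrow> (r, v) \<in> E\<^sup>*"
    using root_reaches_all[OF T] by blast
  from reach[OF \<open>v \<in> V\<close>] show ?thesis
  proof (induction rule: rtrancl_induct)
    case base
    have "w = r" if "(w, r) \<in> E\<^sup>*" for w
      using that r by (auto elim: rtranclE simp: is_root_def)
    then have "{w. (w, r) \<in> E\<^sup>*} \<subseteq> {r}" by blast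
    then show ?case by (rule finite_subset) simp
  next
    case (step p v)
    have "(w, p) \<in> E\<^sup>* \<or> w = v" if "(w, v) \<in> E\<^sup>*" for w
      using that rooted_directed_tree_unique_parent[OF T step.hyps(2)] by (metis rtranclE)
    then have "{w. (w, v) \<in> E\<^sup>*} \<subseteq> insert v {w. (w, p) \<in> E\<^sup>*}" by blast
    then show ?case by (rule finite_subset) (simp add: step.IH)
  qed
qed

lemma Asc_subset_ancestors:
  assumes T: "rooted_directed_tree V E"
  shows "Asc E b \<subseteq> {w. (w, b) \<in> E\<^sup>*}"
proof -
  have par: "(p, v) \<in> E" if "par E v = Some p" for v p
    using that rooted_directed_tree_unique_parent[OF T]
    by (auto simp: par_def split: if_splits intro: theI2)
  have "(w, b) \<in> E\<^sup>*" if "par_iter E n b = Some w" for n w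
    using that
  proof (induction n arbitrary: w)
    case (Suc n)
    then obtain y where "par_iter E n b = Some y" "par E y = Some w"
      by (auto simp: bind_eq_Some_conv)
    then show ?case using Suc.IH par by (blast intro: converse_rtrancl_into_rtrancl)
  qed simp
  then show ?thesis by (auto simp: Asc_def)
qed

lemma ext_edges_path_between_vertices:
  assumes "(Some v, Some u) \<in> (ext_edges V E)\<^sup>*"
  shows "(v, u) \<in> E\<^sup>*"
proof -
  have "\<forall>u. y = Some u \<longrightarrow> (v, u) \<in> E\<^sup>*" if "(Some v, y) \<in> (ext_edges V E)\<^sup>*" for y
    using that
    by (induction rule: rtrancl_induct) (auto simp: ext_edges_def intro: rtrancl_into_rtrancl)
  with assms show ?thesis by blast
qed

text \<open>The join differs from \<open>v\<close> and \<open>\<infinity>\<close> only if the meet applies, or \<open>v = b\<close>, or \<open>u\<close> is a descendant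
  of \<open>v\<close>; in all three cases \<open>v\<close> is an ancestor of \<open>b\<close> or of \<open>u\<close>, if each vertex counts as its own
  ancestor.\<close>

lemma join_at_almost_diagonal:
  assumes T: "rooted_directed_tree V E" and "b \<in> V" "u \<in> V"
  shows "almost_diagonal V (\<lambda>v. join_at V E b (Some u) (Some v))
    ({w. (w, b) \<in> E\<^sup>*} \<union> {w. (w, u) \<in> E\<^sup>*})"
proof
  show "finite ({w. (w, b) \<in> E\<^sup>*} \<union> {w. (w, u) \<in> E\<^sup>*})"
    using finite_ancestors[OF T] assms(2,3) by simp
  fix v assume "v \<notin> {w. (w, b) \<in> E\<^sup>*} \<union> {w. (w, u) \<in> E\<^sup>*}"
  then show "join_at V E b (Some u) (Some v) = Some v \<or> join_at V E b (Some u) (Some v) = None"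
    using Asc_subset_ancestors[OF T, of b]
    by (auto simp: join_at_def join_def Des_def dest: ext_edges_path_between_vertices)
qed

section \<open>Weighted join operators\<close>

theorem proposition3p5:
  fixes V :: "'v set" and E :: "('v \<times> 'v) set" and b u :: 'v
    and lam :: "'v option \<Rightarrow> complex"
  assumes "rooted_directed_tree V E"
    and "countable V" and "infinite V"
    and "b \<in> V" and "u \<in> V"
    and "lam None = 0"
  shows "linear_operator V (weighted_join V E b u lam)
       \<and> dense_in_ell2 V (fst (weighted_join V E b u lam))
       \<and> closed_operator V (weighted_join V E b u lam)
       \<and> is_core V (weighted_join V E b u lam) (module.span scaleF (basis_vec ` V))"
proof -
  interpret almost_diagonal V "\<lambda>v. join_at V E b (Some u) (Some v)" "\<lambda>v. lam (Some v)"
    "{w. (w, b) \<in> E\<^sup>*} \<union> {w. (w, u) \<in> E\<^sup>*}"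
    by (rule join_at_almost_diagonal[OF assms(1,4,5)])
  have eq: "weighted_join V E b u lam = max_op"
    by (simp add: weighted_join_def max_op_def Lam_def row_op_def fun_eq_iff)
  have "dense_in_ell2 V (fst max_op)"
    using dense_in_ell2_mono[OF dense_span_basis_vec span_subset_max_op]
    by (auto simp: max_op_def)
  then show ?thesis
    unfolding eq using linear_max_op closed_max_op span_core_max_op by blast
qed

end
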